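(* Let $a,b\in\mathbb{C}$ and $A=B=\begin{pmatrix}a&b\\0&a\end{pmatrix}$ with $|a|\le\dfrac{\sqrt3-1}{2}|b|$. Then $W_A(B)=W_{A\oplus 0}(B\oplus 0)$, and this set is a circular disc centered at $2a^2$ of radius $|b|^2$.
   Context: $M_n$ is the space of $n\times n$ complex matrices and $U_n$ the group of $n\times n$ unitary matrices. For $A,B\in M_n$, the $A$-numerical range of $B$ is $W_A(B)=\{\operatorname{tr}(A\,VBV^* ) : V\in U_n\}$. For $X\in M_2$, $X\oplus 0\in M_3$ denotes the direct sum of $X$ with the $1\times 1$ zero matrix. A circular disc here is closed. *)

theory Defs
  imports "HOL-Analysis.Analysis"
begin

definition conj_transpose :: "complex^'n^'m \<Rightarrow> complex^'m^'n" where
  "conj_transpose V = (\<chi> i j. cnj (V $ j $ i))"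

definition unitary_matrix :: "complex^'n^'n \<Rightarrow> bool" where
  "unitary_matrix V \<longleftrightarrow>
     conj_transpose V ** V = mat 1 \<and> V ** conj_transpose V = mat 1"

definition numerical_range :: "complex^'n^'n \<Rightarrow> complex^'n^'n \<Rightarrow> complex set" where
  "numerical_range A B =
     {trace (A ** (V ** B ** conj_transpose V)) | V. unitary_matrix V}"

definition direct_sum_zero :: "complex^2^2 \<Rightarrow> complex^3^3" where
  "direct_sum_zero X =
     vector [vector [X $ 1 $ 1, X $ 1 $ 2, 0],
             vector [X $ 2 $ 1, X $ 2 $ 2, 0],
             vector [0, 0, 0]]"

end

theory Submission
  imports Defs
begin

text \<open>
  The three sets coincide because \<open>W\<^sub>A(B) \<subseteq> W\<^bsub>A \<oplus> 0\<^esub>(B \<oplus> 0) \<subseteq> D \<subseteq> W\<^sub>A(B)\<close>, where \<open>D\<close> is the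
  disc with centre \<open>2 a\<^sup>2\<close> and radius \<open>|b|\<^sup>2\<close>.

  The first inclusion holds for arbitrary \<open>2 \<times> 2\<close> matrices, by passing from \<open>V\<close> to \<open>V \<oplus> 1\<close>
  (\<open>numerical_range_subset_direct_sum_zero\<close>).  For the last one, \<open>A = a I + b E\<close> with \<open>E\<close> the
  nilpotent matrix unit gives \<open>tr (A V A V\<^sup>*) = 2 a\<^sup>2 + b\<^sup>2 V\<^sub>2\<^sub>1 cnj V\<^sub>1\<^sub>2\<close> for unitary \<open>V\<close>, and
  \<open>V\<^sub>2\<^sub>1 cnj V\<^sub>1\<^sub>2\<close> takes every value in the closed unit disc (\<open>cball_subset_numerical_range\<close>).

  The middle inclusion (\<open>direct_sum_zero_range_subset_cball\<close>) is where the bound on \<open>a\<close> enters.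
  For a unitary \<open>3 \<times> 3\<close> matrix \<open>V\<close>, put \<open>d = 1 - |V\<^sub>3\<^sub>3|\<^sup>2\<close>.  The orthonormality of the rows and
  columns of \<open>V\<close> allows the trace to be rewritten as
  \<open>2 a\<^sup>2 - a\<^sup>2 d - a b (V\<^sub>3\<^sub>1 cnj V\<^sub>3\<^sub>2 + V\<^sub>2\<^sub>3 cnj V\<^sub>1\<^sub>3) + b\<^sup>2 V\<^sub>2\<^sub>1 cnj V\<^sub>1\<^sub>2\<close>.
  Here \<open>|V\<^sub>3\<^sub>1 V\<^sub>3\<^sub>2|\<close> and \<open>|V\<^sub>2\<^sub>3 V\<^sub>1\<^sub>3|\<close> are at most \<open>d / 2\<close>, and \<open>|V\<^sub>2\<^sub>1 V\<^sub>1\<^sub>2| \<le> 1 - d / 2\<close>, so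
  the distance to \<open>2 a\<^sup>2\<close> is at most \<open>(|a|\<^sup>2 + |a| |b|) d + |b|\<^sup>2 (1 - d / 2)\<close>.  Since
  \<open>(\<surd>3 - 1) / 2\<close> is the positive root of \<open>t\<^sup>2 + t = 1 / 2\<close>, the hypothesis says exactly that
  \<open>|a|\<^sup>2 + |a| |b| \<le> |b|\<^sup>2 / 2\<close>, and the bound is at most \<open>|b|\<^sup>2\<close>.
\<close>

lemma unitary_matrix_columns:
  assumes "unitary_matrix V"
  shows "(\<Sum>k\<in>UNIV. V $ k $ j * cnj (V $ k $ i)) = (if i = j then 1 else 0)"
proof -
  have "(conj_transpose V ** V) $ i $ j = (if i = j then 1 else 0)"
    using assms by (simp add: unitary_matrix_def mat_def)
  then show ?thesis
    by (simp add: matrix_matrix_mult_def conj_transpose_def mult.commute)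
qed

lemma unitary_matrix_rows:
  assumes "unitary_matrix V"
  shows "(\<Sum>k\<in>UNIV. V $ i $ k * cnj (V $ j $ k)) = (if i = j then 1 else 0)"
proof -
  have "(V ** conj_transpose V) $ i $ j = (if i = j then 1 else 0)"
    using assms by (simp add: unitary_matrix_def mat_def)
  then show ?thesis
    by (simp add: matrix_matrix_mult_def conj_transpose_def)
qed

lemma unitary_matrix_column_norm:
  assumes "unitary_matrix V"
  shows "(\<Sum>k\<in>UNIV. (cmod (V $ k $ j))\<^sup>2) = 1"
proof -
  have "complex_of_real (\<Sum>k\<in>UNIV. (cmod (V $ k $ j))\<^sup>2) = complex_of_real 1"
    using unitary_matrix_columns[OF assms, of j j] by (simp add: complex_norm_square del: of_real_power)
  then show ?thesis
    by (simp only: of_real_eq_iff)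
qed

lemma unitary_matrix_row_norm:
  assumes "unitary_matrix V"
  shows "(\<Sum>k\<in>UNIV. (cmod (V $ i $ k))\<^sup>2) = 1"
proof -
  have "complex_of_real (\<Sum>k\<in>UNIV. (cmod (V $ i $ k))\<^sup>2) = complex_of_real 1"
    using unitary_matrix_rows[OF assms, of i i] by (simp add: complex_norm_square del: of_real_power)
  then show ?thesis
    by (simp only: of_real_eq_iff)
qed

lemma numerical_range_subset_direct_sum_zero:
  "numerical_range X Y \<subseteq> numerical_range (direct_sum_zero X) (direct_sum_zero Y)"
proof
  fix z assume "z \<in> numerical_range X Y"
  then obtain V where V: "unitary_matrix V"
    and z: "z = trace (X ** (V ** Y ** conj_transpose V))"
    by (auto simp: numerical_range_def)
  define U :: "complex^3^3" where
    "U = vector [vector [V $ 1 $ 1, V $ 1 $ 2, 0], vector [V $ 2 $ 1, V $ 2 $ 2, 0], vector [0, 0, 1]]"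
  have "unitary_matrix U"
    using V unfolding unitary_matrix_def U_def
    by (simp add: vec_eq_iff matrix_matrix_mult_def conj_transpose_def mat_def
        forall_2 forall_3 sum_2 sum_3)
  moreover have "z = trace (direct_sum_zero X ** (U ** direct_sum_zero Y ** conj_transpose U))"
    unfolding z U_def direct_sum_zero_def
    by (simp add: trace_def matrix_matrix_mult_def conj_transpose_def sum_2 sum_3)
  ultimately show "z \<in> numerical_range (direct_sum_zero X) (direct_sum_zero Y)"
    by (auto simp: numerical_range_def)
qed

lemma cball_subset_numerical_range:
  fixes a b :: complex and A :: "complex^2^2"
  assumes A: "A = vector [vector [a, b], vector [0, a]]"
  shows "cball (2 * a\<^sup>2) ((cmod b)\<^sup>2) \<subseteq> numerical_range A A"
proof
  fix z assume z: "z \<in> cball (2 * a\<^sup>2) ((cmod b)\<^sup>2)"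
  \<comment> \<open>If \<open>b = 0\<close>, the quotient is \<open>0\<close> and the disc is the single point \<open>2 a\<^sup>2\<close>.\<close>
  define w where "w = (z - 2 * a\<^sup>2) / b\<^sup>2"
  have zw: "z = 2 * a\<^sup>2 + b\<^sup>2 * w"
    using z by (cases "b = 0") (auto simp: w_def)
  have w1: "cmod w \<le> 1"
    using z by (cases "b = 0")
      (auto simp: w_def norm_divide norm_power dist_norm norm_minus_commute field_simps)
  \<comment> \<open>A polar form of \<open>w\<close> with unimodular phase \<open>u\<close>, also when \<open>w = 0\<close>.\<close>
  obtain u :: complex where u: "cmod u = 1" "w = cmod w * u"
    using rcis_cmod_Arg[of w] norm_cis[of "Arg w"] unfolding rcis_def by metis
  define s c where "s = complex_of_real (sqrt (cmod w))" and "c = complex_of_real (sqrt (1 - cmod w))"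
  have ss: "s * s = cmod w" and cc: "c * c = 1 - cmod w"
    using w1 by (simp_all add: s_def c_def flip: of_real_mult)
  have sum1: "c * c + s * s = 1" "s * s + c * c = 1"
    by (simp_all add: ss cc)
  have real: "cnj s = s" "cnj c = c"
    by (simp_all add: s_def c_def)
  have uu: "u * cnj u = 1"
    using u(1) by (metis complex_norm_square of_real_1 one_power2)
  \<comment> \<open>A reflection with its second row turned by the phase \<open>u\<close>, so that
    \<open>V\<^sub>2\<^sub>1 cnj V\<^sub>1\<^sub>2 = s\<^sup>2 u = w\<close>.\<close>
  define V :: "complex^2^2" where "V = vector [vector [c, s], vector [s * u, - (c * u)]]"
  have "unitary_matrix V"
    using sum1
    by (simp add: unitary_matrix_def V_def real uu vec_eq_iff matrix_matrix_mult_def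
        conj_transpose_def mat_def forall_2 sum_2 algebra_simps)
  moreover have "z = trace (A ** (V ** A ** conj_transpose V))"
  proof -
    have "trace (A ** (V ** A ** conj_transpose V)) =
        a\<^sup>2 * ((c * c + s * s) + (u * cnj u) * (s * s + c * c))
        + a * b * (c * s * (1 - u * cnj u)) + b\<^sup>2 * ((s * s) * u)"
      by (simp add: A V_def real trace_def matrix_matrix_mult_def conj_transpose_def sum_2
          algebra_simps power2_eq_square)
    also have "\<dots> = 2 * a\<^sup>2 + b\<^sup>2 * ((s * s) * u)"
      unfolding sum1 uu by simp
    also have "\<dots> = z"
      unfolding ss zw by (simp flip: u(2))
    finally show ?thesis ..
  qed
  ultimately show "z \<in> numerical_range A A"
    by (auto simp: numerical_range_def)
qed

lemma direct_sum_zero_range_subset_cball: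
  fixes a b :: complex and A :: "complex^2^2"
  assumes A: "A = vector [vector [a, b], vector [0, a]]"
    and ab: "cmod a \<le> (sqrt 3 - 1) / 2 * cmod b"
  shows "numerical_range (direct_sum_zero A) (direct_sum_zero A) \<subseteq> cball (2 * a\<^sup>2) ((cmod b)\<^sup>2)"
proof
  fix z assume "z \<in> numerical_range (direct_sum_zero A) (direct_sum_zero A)"
  then obtain V where V: "unitary_matrix V"
    and z: "z = trace (direct_sum_zero A ** (V ** direct_sum_zero A ** conj_transpose V))"
    by (auto simp: numerical_range_def)
  define n where "n i j = (cmod (V $ i $ j))\<^sup>2" for i j
  have n0: "n i j \<ge> 0" for i j
    by (simp add: n_def)
  have sq: "complex_of_real (n i j) = V $ i $ j * cnj (V $ i $ j)" for i j
    by (simp add: n_def complex_norm_square del: of_real_power)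
  have col: "n 1 j + n 2 j + n 3 j = 1" and row: "n j 1 + n j 2 + n j 3 = 1" for j
    using unitary_matrix_column_norm[OF V, of j] unitary_matrix_row_norm[OF V, of j]
    by (simp_all add: n_def sum_3)
  define d where "d = 1 - n 3 3"
  have d_row: "n 3 1 + n 3 2 = d" and d_col: "n 1 3 + n 2 3 = d"
    using col[of 3] row[of 3] by (simp_all add: d_def)
  have d0: "d \<ge> 0"
    using d_row n0[of 3 1] n0[of 3 2] by simp

  define p where "p = V $ 3 $ 1 * cnj (V $ 3 $ 2) + V $ 2 $ 3 * cnj (V $ 1 $ 3)"
  define q where "q = V $ 2 $ 1 * cnj (V $ 1 $ 2)"
  have "z = a\<^sup>2 * (n 1 1 + n 1 2 + n 2 1 + n 2 2)
      + a * b * ((V $ 1 $ 1 * cnj (V $ 1 $ 2) + V $ 2 $ 1 * cnj (V $ 2 $ 2))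
               + (V $ 2 $ 1 * cnj (V $ 1 $ 1) + V $ 2 $ 2 * cnj (V $ 1 $ 2)))
      + b\<^sup>2 * q"
    unfolding z
    by (simp add: A sq q_def direct_sum_zero_def trace_def matrix_matrix_mult_def conj_transpose_def
        sum_2 sum_3 algebra_simps power2_eq_square)
  also have "n 1 1 + n 1 2 + n 2 1 + n 2 2 = 2 - d"
    using row[of 1] row[of 2] d_col by simp
  also have "(V $ 1 $ 1 * cnj (V $ 1 $ 2) + V $ 2 $ 1 * cnj (V $ 2 $ 2))
      + (V $ 2 $ 1 * cnj (V $ 1 $ 1) + V $ 2 $ 2 * cnj (V $ 1 $ 2)) = - p"
  proof -
    have "V $ 1 $ 1 * cnj (V $ 1 $ 2) + V $ 2 $ 1 * cnj (V $ 2 $ 2) + V $ 3 $ 1 * cnj (V $ 3 $ 2) = 0"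
      using unitary_matrix_columns[OF V, of 1 2] by (simp add: sum_3)
    moreover have "V $ 2 $ 1 * cnj (V $ 1 $ 1) + V $ 2 $ 2 * cnj (V $ 1 $ 2)
        + V $ 2 $ 3 * cnj (V $ 1 $ 3) = 0"
      using unitary_matrix_rows[OF V, of 2 1] by (simp add: sum_3)
    ultimately show ?thesis
      unfolding p_def by algebra
  qed
  finally have diff: "z - 2 * a\<^sup>2 = b\<^sup>2 * q - (a\<^sup>2 * d + a * b * p)"
    by (simp add: algebra_simps)

  have am_gm: "cmod (V $ i $ j * cnj (V $ k $ l)) \<le> (n i j + n k l) / 2" for i j k l
    using sum_squares_bound[of "cmod (V $ i $ j)" "cmod (V $ k $ l)"]
    by (simp add: n_def norm_mult)
  have p: "cmod p \<le> d"
    using norm_triangle_le[of "V $ 3 $ 1 * cnj (V $ 3 $ 2)" "V $ 2 $ 3 * cnj (V $ 1 $ 3)" d]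
      am_gm[of 3 1 3 2] am_gm[of 2 3 1 3] d_row d_col
    by (simp add: p_def)
  \<comment> \<open>Averaging the row and column constraints gives
    \<open>n 2 1 \<le> 1 - (n 2 3 + n 3 1) / 2\<close> and \<open>n 1 2 \<le> 1 - (n 1 3 + n 3 2) / 2\<close>.\<close>
  have q: "cmod q \<le> 1 - d / 2"
    using am_gm[of 2 1 1 2] row[of 1] row[of 2] col[of 1] col[of 2] d_row d_col
      n0[of 1 1] n0[of 2 2]
    by (simp add: q_def)

  define t where "t = (sqrt 3 - 1) / (2 :: real)"
  have t: "t\<^sup>2 + t = 1 / 2" "t \<ge> 0"
    by (simp_all add: t_def power2_eq_square field_simps)
  have ab2: "(cmod a)\<^sup>2 + cmod a * cmod b \<le> (cmod b)\<^sup>2 / 2"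
  proof -
    have le: "cmod a \<le> t * cmod b"
      using ab by (simp add: t_def)
    have "(cmod a)\<^sup>2 + cmod a * cmod b \<le> (t * cmod b)\<^sup>2 + (t * cmod b) * cmod b"
      using le by (intro add_mono power_mono mult_right_mono) auto
    also have "\<dots> = (t\<^sup>2 + t) * (cmod b)\<^sup>2"
      by (simp add: algebra_simps power2_eq_square)
    finally show ?thesis
      by (simp add: t)
  qed

  have "cmod (z - 2 * a\<^sup>2) \<le> cmod (b\<^sup>2 * q) + (cmod (a\<^sup>2 * d) + cmod (a * b * p))"
    unfolding diff by (intro order_trans[OF norm_triangle_ineq4] add_left_mono norm_triangle_ineq)
  also have "\<dots> \<le> (cmod b)\<^sup>2 * (1 - d / 2) + ((cmod a)\<^sup>2 * d + cmod a * cmod b * d)"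
    using p q d0 by (simp add: norm_mult norm_power) (intro add_mono mult_left_mono, auto)
  also have "\<dots> = (cmod b)\<^sup>2 * (1 - d / 2) + ((cmod a)\<^sup>2 + cmod a * cmod b) * d"
    by (simp add: algebra_simps)
  also have "\<dots> \<le> (cmod b)\<^sup>2 * (1 - d / 2) + (cmod b)\<^sup>2 / 2 * d"
    using ab2 d0 by (intro add_left_mono mult_right_mono)
  also have "\<dots> = (cmod b)\<^sup>2"
    by (simp add: algebra_simps)
  finally show "z \<in> cball (2 * a\<^sup>2) ((cmod b)\<^sup>2)"
    by (simp add: dist_norm norm_minus_commute)
qed

theorem corollary14:
  fixes a b :: complex and A B :: "complex^2^2"
  assumes "A = vector [vector [a, b], vector [0, a]]"
    and "B = A"
    and "cmod a \<le> (sqrt 3 - 1) / 2 * cmod b"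
  shows "numerical_range A B = numerical_range (direct_sum_zero A) (direct_sum_zero B)
       \<and> numerical_range A B = cball (2 * a\<^sup>2) ((cmod b)\<^sup>2)"
  using numerical_range_subset_direct_sum_zero[of A A] cball_subset_numerical_range[OF assms(1)]
    direct_sum_zero_range_subset_cball[OF assms(1,3)] assms(2)
  by blast

end
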